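(* Over $\mathrm{ZF}$, the following are equivalent: (1) the posets $\mathrm{D}'(\mathbf 2)$ and $P\,\mathrm{D}(\mathbf{Set})$ are order-isomorphic; (2) the Axiom of Choice holds.
   Context: The category $\mathrm{D}(\mathbf{Set})$: objects are triples $(\alpha,U,X)$ with $U,X$ sets and $\alpha\subseteq U\times X$. A morphism $(\alpha,U,X)\to(\beta,V,Y)$ is a pair of functions $f\colon U\to V$, $F\colon U\times Y\to X$ such that for all $u\in U$, $y\in Y$: if $(u,F(u,y))\in\alpha$ then $(f(u),y)\in\beta$. The poset reflection $P(\mathbf C)$ of a category $\mathbf C$ is the partial order obtained by preordering the objects of $\mathbf C$ by $A\le B$ iff there exists a morphism $A\to B$, and then identifying $A$ and $B$ whenever $A\le B$ and $B\le A$. $\mathbf 2=\{0<1\}$ is the two-element Boolean algebra. For a meet-semilattice $\mathbf M=(M,\le,\wedge,1)$ with top element $1$, $\mathrm{D}'(\mathbf M)$ is the set of triples $\{(a,u,x)\in M^3 : a\le x\le u\}$ ordered by: $(a,u,x)\le(b,v,y)$ iff $u\le v$, $u\wedge y\le x$, and $a\wedge(u\wedge y)\le b\wedge(u\wedge y)$. *)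

theory Defs
  imports Main
begin

definition order_isomorphic ::
  "'a set \<Rightarrow> ('a \<Rightarrow> 'a \<Rightarrow> bool) \<Rightarrow> 'b set \<Rightarrow> ('b \<Rightarrow> 'b \<Rightarrow> bool) \<Rightarrow> bool" where
  "order_isomorphic A leA B leB \<longleftrightarrow>
     (\<exists>h. bij_betw h A B \<and> (\<forall>x\<in>A. \<forall>y\<in>A. leA x y \<longleftrightarrow> leB (h x) (h y)))"

text \<open>The poset reflection depends only on the objects and the hom-sets of a category.\<close>

definition hom_le :: "('o \<Rightarrow> 'o \<Rightarrow> 'm set) \<Rightarrow> 'o \<Rightarrow> 'o \<Rightarrow> bool" where
  "hom_le Hom A B \<longleftrightarrow> (\<exists>m. m \<in> Hom A B)"

definition hom_equiv :: "'o set \<Rightarrow> ('o \<Rightarrow> 'o \<Rightarrow> 'm set) \<Rightarrow> ('o \<times> 'o) set" where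
  "hom_equiv Obj Hom = {(A, B). A \<in> Obj \<and> B \<in> Obj \<and> hom_le Hom A B \<and> hom_le Hom B A}"

definition poset_reflection :: "'o set \<Rightarrow> ('o \<Rightarrow> 'o \<Rightarrow> 'm set) \<Rightarrow> 'o set set" where
  "poset_reflection Obj Hom = Obj // hom_equiv Obj Hom"

definition poset_reflection_le :: "('o \<Rightarrow> 'o \<Rightarrow> 'm set) \<Rightarrow> 'o set \<Rightarrow> 'o set \<Rightarrow> bool" where
  "poset_reflection_le Hom P Q \<longleftrightarrow> (\<exists>A\<in>P. \<exists>B\<in>Q. hom_le Hom A B)"

definition dprime :: "('a::bounded_semilattice_inf_top \<times> 'a \<times> 'a) set" where
  "dprime = {(a, u, x). a \<le> x \<and> x \<le> u}"

definition dprime_le ::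
  "('a::bounded_semilattice_inf_top \<times> 'a \<times> 'a) \<Rightarrow> ('a \<times> 'a \<times> 'a) \<Rightarrow> bool" where
  "dprime_le = (\<lambda>(a, u, x) (b, v, y).
     u \<le> v \<and> inf u y \<le> x \<and> inf a (inf u y) \<le> inf b (inf u y))"

text \<open>
  HOL has a choice operator, so the theory ZF is represented by its models: structures
  consisting of a type \<open>'v\<close> with a binary relation. The axiom schemes of separation
  and replacement must range over first-order formulas with parameters; if they ranged over
  all HOL predicates on \<open>'v\<close>, then choice in HOL would already force choice in every model.
  Variables are named by natural numbers and \<open>FAll n\<close> binds the variable \<open>n\<close>.
\<close>

datatype fm = FMem nat nat | FEq nat nat | FNeg fm | FConj fm fm | FAll nat fm

primrec sat :: "('v \<Rightarrow> 'v \<Rightarrow> bool) \<Rightarrow> fm \<Rightarrow> (nat \<Rightarrow> 'v) \<Rightarrow> bool" where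
  "sat E (FMem m n) s \<longleftrightarrow> E (s m) (s n)"
| "sat E (FEq m n) s \<longleftrightarrow> s m = s n"
| "sat E (FNeg p) s \<longleftrightarrow> \<not> sat E p s"
| "sat E (FConj p q) s \<longleftrightarrow> sat E p s \<and> sat E q s"
| "sat E (FAll n p) s \<longleftrightarrow> (\<forall>x. sat E p (s(n := x)))"

text \<open>
  All sets, relations and functions below are elements of the structure, and every quantifier
  ranges over the structure.
\<close>

locale set_structure =
  fixes E :: "'v \<Rightarrow> 'v \<Rightarrow> bool" (infix \<open>\<epsilon>\<close> 50)
begin

definition is_upair :: "'v \<Rightarrow> 'v \<Rightarrow> 'v \<Rightarrow> bool" where
  "is_upair a b c \<longleftrightarrow> (\<forall>z. z \<epsilon> c \<longleftrightarrow> z = a \<or> z = b)"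

definition is_pair :: "'v \<Rightarrow> 'v \<Rightarrow> 'v \<Rightarrow> bool" where
  "is_pair a b p \<longleftrightarrow> (\<exists>s t. is_upair a a s \<and> is_upair a b t \<and> is_upair s t p)"

definition related :: "'v \<Rightarrow> 'v \<Rightarrow> 'v \<Rightarrow> bool" where
  "related R a b \<longleftrightarrow> (\<exists>p. is_pair a b p \<and> p \<epsilon> R)"

definition is_rel :: "'v \<Rightarrow> 'v \<Rightarrow> 'v \<Rightarrow> bool" where
  "is_rel R A B \<longleftrightarrow> (\<forall>p. p \<epsilon> R \<longrightarrow> (\<exists>a b. a \<epsilon> A \<and> b \<epsilon> B \<and> is_pair a b p))"

definition is_func :: "'v \<Rightarrow> 'v \<Rightarrow> 'v \<Rightarrow> bool" where
  "is_func f A B \<longleftrightarrow> is_rel f A B \<and> (\<forall>a. a \<epsilon> A \<longrightarrow> (\<exists>!b. related f a b))"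

definition is_prod :: "'v \<Rightarrow> 'v \<Rightarrow> 'v \<Rightarrow> bool" where
  "is_prod A B C \<longleftrightarrow> (\<forall>p. p \<epsilon> C \<longleftrightarrow> (\<exists>a b. a \<epsilon> A \<and> b \<epsilon> B \<and> is_pair a b p))"

definition axiom_of_choice :: bool where
  "axiom_of_choice \<longleftrightarrow>
     (\<forall>S. (\<forall>s. s \<epsilon> S \<longrightarrow> (\<exists>x. x \<epsilon> s)) \<longrightarrow>
       (\<exists>f W. is_func f S W \<and> (\<forall>s x. s \<epsilon> S \<longrightarrow> related f s x \<longrightarrow> x \<epsilon> s)))"

text \<open>
  The category D(Set), where Set is the category of sets of the structure. Objects are HOL
  triples \<open>(\<alpha>, U, X)\<close> and morphisms HOL pairs \<open>(f, F)\<close> of elements of the structure.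
\<close>

definition DSet_obj :: "('v \<times> 'v \<times> 'v) set" where
  "DSet_obj = {(\<alpha>, U, X). is_rel \<alpha> U X}"

definition DSet_hom :: "'v \<times> 'v \<times> 'v \<Rightarrow> 'v \<times> 'v \<times> 'v \<Rightarrow> ('v \<times> 'v) set" where
  "DSet_hom = (\<lambda>(\<alpha>, U, X) (\<beta>, V, Y).
     {(f, F). is_func f U V \<and> (\<exists>W. is_prod U Y W \<and> is_func F W X) \<and>
        (\<forall>u y p x v. u \<epsilon> U \<and> y \<epsilon> Y \<and> is_pair u y p \<and> related F p x \<and> related f u v \<longrightarrow>
           related \<alpha> u x \<longrightarrow> related \<beta> v y)})"

text \<open>
  The elements of the poset reflection are equivalence classes that are proper classes of
  the structure, hence HOL sets rather than elements of the structure.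
\<close>

definition PDSet :: "('v \<times> 'v \<times> 'v) set set" where
  "PDSet = poset_reflection DSet_obj DSet_hom"

definition PDSet_le :: "('v \<times> 'v \<times> 'v) set \<Rightarrow> ('v \<times> 'v \<times> 'v) set \<Rightarrow> bool" where
  "PDSet_le = poset_reflection_le DSet_hom"

text \<open>
  With \<^typ>\<open>bool\<close> as the two-element Boolean algebra, \<open>dprime\<close> is finite, so
  an isomorphism from it to \<open>PDSet\<close> is determined by a
  representative for each of finitely many classes, that is, by finitely many elements of the
  structure; so its existence as a HOL function is equivalent to its existence as a class
  definable with parameters in the structure, and is a first-order statement about the
  structure.
\<close>

end

locale ZF_model = set_structure E for E :: "'v \<Rightarrow> 'v \<Rightarrow> bool" (infix \<open>\<epsilon>\<close> 50) +
  assumes extensionality: "\<forall>a b. (\<forall>z. z \<epsilon> a \<longleftrightarrow> z \<epsilon> b) \<longrightarrow> a = b"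
    and foundation: "\<forall>a. (\<exists>x. x \<epsilon> a) \<longrightarrow> (\<exists>x. x \<epsilon> a \<and> \<not> (\<exists>y. y \<epsilon> x \<and> y \<epsilon> a))"
    and pairing: "\<forall>a b. \<exists>c. a \<epsilon> c \<and> b \<epsilon> c"
    and union: "\<forall>a. \<exists>b. \<forall>x. x \<epsilon> b \<longleftrightarrow> (\<exists>y. x \<epsilon> y \<and> y \<epsilon> a)"
    and power_set: "\<forall>a. \<exists>p. \<forall>x. x \<epsilon> p \<longleftrightarrow> (\<forall>z. z \<epsilon> x \<longrightarrow> z \<epsilon> a)"
    and infinity: "\<exists>w. (\<exists>e. e \<epsilon> w \<and> (\<forall>z. \<not> z \<epsilon> e)) \<and>
      (\<forall>x. x \<epsilon> w \<longrightarrow> (\<exists>y. y \<epsilon> w \<and> (\<forall>z. z \<epsilon> y \<longleftrightarrow> z \<epsilon> x \<or> z = x)))"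
    and separation: "\<forall>\<phi> s a. \<exists>b. \<forall>x. x \<epsilon> b \<longleftrightarrow> x \<epsilon> a \<and> sat E \<phi> (s(0 := x))"
    and replacement: "\<forall>\<phi> s a. (\<forall>x. x \<epsilon> a \<longrightarrow> (\<exists>!y. sat E \<phi> (s(0 := x, 1 := y)))) \<longrightarrow>
      (\<exists>b. \<forall>y. y \<epsilon> b \<longleftrightarrow> (\<exists>x. x \<epsilon> a \<and> sat E \<phi> (s(0 := x, 1 := y))))"

end

theory Submission
  imports Defs
begin

text \<open>
  Give an object \<open>(\<alpha>, U, X)\<close> the truth values of ``\<open>U\<close> is inhabited'', ``moreover \<open>X\<close> is
  inhabited'', and ``moreover some \<open>u\<close> in \<open>U\<close> is \<open>\<alpha>\<close>-related to all of \<open>X\<close>''. They form an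
  element of \<open>dprime\<close> over \<^typ>\<open>bool\<close>, the shadow of the object. In any model of ZF the shadow is
  monotone along morphisms and every element of \<open>dprime\<close> is a shadow (lemmas \<open>shadow_mono\<close> and
  \<open>shadow_witness\<close>).

  Conversely, an inequality of shadows is realised by a morphism, usually with constant
  components. The exception is a source with inhabited \<open>U\<close> in which every \<open>u\<close> is refuted by some
  \<open>x\<close> in \<open>X\<close>, the pair \<open>(u, x)\<close> lying outside \<open>\<alpha>\<close>: here \<open>F(u, y)\<close> may have to be such a
  refutation, and choice is used to pick one for each \<open>u\<close> (\<open>choice_imp_uniformization\<close>). Hence,
  under choice, the shadow reflects the preorder and induces an isomorphism.

  In the other direction an isomorphism makes the poset reflection as large as the finite set
  \<open>dprime\<close>. The shadow maps the classes onto \<open>dprime\<close>, so counting shows that objects of equal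
  shadow are equivalent. In particular a nonempty set \<open>S\<close> of inhabited sets yields the object
  (non-membership, \<open>S\<close>, \<open>\<Union>S\<close>), which has the same shadow as the empty relation on a singleton; a
  morphism from the former to the latter has as its backward component a choice function for \<open>S\<close>.
\<close>

section \<open>Invariants of a poset reflection\<close>

lemma order_isomorphic_reflection_of_invariant:
  assumes surj: "g ` Obj = D"
    and reflects: "\<And>A B. A \<in> Obj \<Longrightarrow> B \<in> Obj \<Longrightarrow> hom_le Hom A B \<longleftrightarrow> le (g A) (g B)"
    and refl: "\<And>d. d \<in> D \<Longrightarrow> le d d"
    and antisym: "\<And>d e. d \<in> D \<Longrightarrow> e \<in> D \<Longrightarrow> le d e \<Longrightarrow> le e d \<Longrightarrow> d = e"
  shows "order_isomorphic D le (poset_reflection Obj Hom) (poset_reflection_le Hom)"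
proof -
  define fibre where "fibre d = {A \<in> Obj. g A = d}" for d
  have equiv: "(A, B) \<in> hom_equiv Obj Hom \<longleftrightarrow> A \<in> Obj \<and> B \<in> Obj \<and> g A = g B" for A B
    using surj reflects refl antisym unfolding hom_equiv_def by auto
  have class_fibre: "hom_equiv Obj Hom `` {A} = fibre (g A)" if "A \<in> Obj" for A
    using that equiv by (auto simp: fibre_def)
  have inhabited: "\<exists>A. A \<in> fibre d" if "d \<in> D" for d
    using that surj by (auto simp: fibre_def)
  have "fibre ` D = poset_reflection Obj Hom"
    using class_fibre surj unfolding poset_reflection_def quotient_def by auto
  moreover have "inj_on fibre D"
  proof (rule inj_onI)
    fix d e assume "d \<in> D" "e \<in> D" "fibre d = fibre e"
    then show "d = e" using inhabited[of d] by (auto simp: fibre_def)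
  qed
  moreover have "le d e \<longleftrightarrow> poset_reflection_le Hom (fibre d) (fibre e)"
    if "d \<in> D" "e \<in> D" for d e
  proof -
    have *: "hom_le Hom A B \<longleftrightarrow> le d e" if "A \<in> fibre d" "B \<in> fibre e" for A B
      using that reflects by (auto simp: fibre_def)
    then show ?thesis
      using inhabited[OF that(1)] inhabited[OF that(2)]
      unfolding poset_reflection_le_def by blast
  qed
  ultimately show ?thesis
    unfolding order_isomorphic_def bij_betw_def by blast
qed

text \<open>
  The classes of the objects \<open>c d\<close> are pairwise distinct, and as numerous as \<open>D\<close>; if the
  reflection has no more classes than that, every object lies in one of them.
\<close>

lemma equivalent_to_section_of_invariant:
  assumes "finite D"
    and section_of: "\<And>d. d \<in> D \<Longrightarrow> c d \<in> Obj \<and> g (c d) = d"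
    and section_refl: "\<And>d. d \<in> D \<Longrightarrow> hom_le Hom (c d) (c d)"
    and range: "\<And>A. A \<in> Obj \<Longrightarrow> g A \<in> D"
    and mono: "\<And>A B. A \<in> Obj \<Longrightarrow> B \<in> Obj \<Longrightarrow> hom_le Hom A B \<Longrightarrow> le (g A) (g B)"
    and antisym: "\<And>d e. d \<in> D \<Longrightarrow> e \<in> D \<Longrightarrow> le d e \<Longrightarrow> le e d \<Longrightarrow> d = e"
    and iso: "order_isomorphic D le (poset_reflection Obj Hom) le'"
    and "A \<in> Obj"
  shows "(A, c (g A)) \<in> hom_equiv Obj Hom"
proof -
  let ?r = "hom_equiv Obj Hom"
  let ?k = "\<lambda>d. ?r `` {c d}"
  have invariant: "g A = g B" if "(A, B) \<in> ?r" for A B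
    using that range mono antisym unfolding hom_equiv_def by auto
  have own_class: "c d \<in> ?k d" if "d \<in> D" for d
    using section_of section_refl that by (auto simp: hom_equiv_def)
  have inj: "inj_on ?k D"
  proof (rule inj_onI)
    fix d e assume "d \<in> D" "e \<in> D" "?k d = ?k e"
    then have "(c e, c d) \<in> ?r" using own_class by blast
    then show "d = e" using invariant section_of \<open>d \<in> D\<close> \<open>e \<in> D\<close> by metis
  qed
  have sub: "?k ` D \<subseteq> poset_reflection Obj Hom"
    using section_of by (auto simp: poset_reflection_def quotient_def)
  obtain h where h: "bij_betw h D (poset_reflection Obj Hom)"
    using iso unfolding order_isomorphic_def by blast
  have "finite (poset_reflection Obj Hom)"
    using h \<open>finite D\<close> bij_betw_finite by blast
  moreover have "card (?k ` D) = card (poset_reflection Obj Hom)"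
    using card_image[OF inj] bij_betw_same_card[OF h] by simp
  ultimately have "?k ` D = poset_reflection Obj Hom"
    using sub by (simp add: card_subset_eq)
  moreover have "?r `` {A} \<in> poset_reflection Obj Hom"
    using \<open>A \<in> Obj\<close> by (auto simp: poset_reflection_def quotient_def)
  ultimately obtain d where d: "d \<in> D" "?r `` {A} = ?k d" by auto
  then have "(A, c d) \<in> ?r" using own_class by blast
  moreover have "g A = d" using invariant[OF calculation] section_of d by simp
  ultimately show ?thesis by simp
qed

section \<open>Formulas for pairs and relations\<close>

definition FEx :: "nat \<Rightarrow> fm \<Rightarrow> fm" where
  "FEx n p = FNeg (FAll n (FNeg p))"

definition FIff :: "fm \<Rightarrow> fm \<Rightarrow> fm" where
  "FIff p q = FConj (FNeg (FConj p (FNeg q))) (FNeg (FConj q (FNeg p)))"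

lemma sat_FEx [simp]: "sat E (FEx n p) s \<longleftrightarrow> (\<exists>x. sat E p (s(n := x)))"
  by (simp add: FEx_def)

lemma sat_FIff [simp]: "sat E (FIff p q) s \<longleftrightarrow> (sat E p s \<longleftrightarrow> sat E q s)"
  by (auto simp: FIff_def)

text \<open>
  In the following formulas the last argument \<open>k\<close> is a supply of bound variables: all variables
  from \<open>k\<close> on may be rebound, so the free ones have to be below \<open>k\<close>.
\<close>

definition FUpair :: "nat \<Rightarrow> nat \<Rightarrow> nat \<Rightarrow> nat \<Rightarrow> fm" where
  "FUpair a b c k =
     FAll k (FIff (FMem k c) (FNeg (FConj (FNeg (FEq k a)) (FNeg (FEq k b)))))"

definition FPair :: "nat \<Rightarrow> nat \<Rightarrow> nat \<Rightarrow> nat \<Rightarrow> fm" where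
  "FPair a b p k =
     FEx k (FEx (k + 1) (FConj (FUpair a a k (k + 2))
       (FConj (FUpair a b (k + 1) (k + 2)) (FUpair k (k + 1) p (k + 2)))))"

definition FRelated :: "nat \<Rightarrow> nat \<Rightarrow> nat \<Rightarrow> nat \<Rightarrow> fm" where
  "FRelated R a b k = FEx k (FConj (FPair a b k (k + 1)) (FMem k R))"

context set_structure
begin

lemma sat_FUpair [simp]:
  "a < k \<Longrightarrow> b < k \<Longrightarrow> c < k \<Longrightarrow> sat E (FUpair a b c k) s \<longleftrightarrow> is_upair (s a) (s b) (s c)"
  unfolding FUpair_def is_upair_def by auto

lemma sat_FPair [simp]:
  "a < k \<Longrightarrow> b < k \<Longrightarrow> p < k \<Longrightarrow> sat E (FPair a b p k) s \<longleftrightarrow> is_pair (s a) (s b) (s p)"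
  unfolding FPair_def is_pair_def by simp

lemma sat_FRelated [simp]:
  "R < k \<Longrightarrow> a < k \<Longrightarrow> b < k \<Longrightarrow> sat E (FRelated R a b k) s \<longleftrightarrow> related (s R) (s a) (s b)"
  unfolding FRelated_def related_def by simp

end

section \<open>Relations and functions in a model of ZF\<close>

context ZF_model
begin

lemma ex_empty: "\<exists>e. \<forall>z. \<not> z \<epsilon> e"
proof -
  have "\<exists>b. \<forall>x. x \<epsilon> b \<longleftrightarrow> x \<epsilon> undefined \<and> sat E (FNeg (FEq 0 0)) (undefined(0 := x))"
    using separation by blast
  then show ?thesis by simp
qed

lemma ex_upair: "\<exists>c. is_upair a b c"
proof -
  obtain c where c: "a \<epsilon> c" "b \<epsilon> c" using pairing by blast
  let ?s = "undefined(1 := a, 2 := b)"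
  have "\<exists>d. \<forall>x. x \<epsilon> d \<longleftrightarrow>
      x \<epsilon> c \<and> sat E (FNeg (FConj (FNeg (FEq 0 1)) (FNeg (FEq 0 2)))) (?s(0 := x))"
    using separation by blast
  then obtain d where "\<forall>x. x \<epsilon> d \<longleftrightarrow> x \<epsilon> c \<and> (x = a \<or> x = b)" by auto
  then have "is_upair a b d" unfolding is_upair_def using c by blast
  then show ?thesis ..
qed

lemma ex_pair: "\<exists>p. is_pair a b p"
  unfolding is_pair_def using ex_upair by blast

lemma upair_unique: "is_upair a b c \<Longrightarrow> is_upair a b d \<Longrightarrow> c = d"
  unfolding is_upair_def using extensionality by blast

lemma pair_unique: "is_pair a b p \<Longrightarrow> is_pair a b q \<Longrightarrow> p = q"
  unfolding is_pair_def using upair_unique by metis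

lemma pair_inject:
  assumes "is_pair a b p" "is_pair c d p"
  shows "a = c" "b = d"
proof -
  obtain s t where s: "is_upair a a s" and t: "is_upair a b t" and p: "is_upair s t p"
    using assms(1) unfolding is_pair_def by blast
  obtain s' t' where s': "is_upair c c s'" and t': "is_upair c d t'" and p': "is_upair s' t' p"
    using assms(2) unfolding is_pair_def by blast
  have cases: "s = s' \<or> s = t'" "t = s' \<or> t = t'" "s' = s \<or> s' = t" "t' = s \<or> t' = t"
    using p p' unfolding is_upair_def by metis+
  show "a = c" using cases s s' t t' unfolding is_upair_def by metis
  then show "b = d" using cases s s' t t' unfolding is_upair_def by metis
qed

lemma related_pair: "is_pair a b p \<Longrightarrow> related R a b \<longleftrightarrow> p \<epsilon> R"
  unfolding related_def using pair_unique by blast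

lemma rel_related: "is_rel R A B \<Longrightarrow> related R a b \<Longrightarrow> a \<epsilon> A \<and> b \<epsilon> B"
  unfolding is_rel_def related_def using pair_inject by metis

lemma func_related: "is_func f A B \<Longrightarrow> related f a b \<Longrightarrow> a \<epsilon> A \<and> b \<epsilon> B"
  unfolding is_func_def using rel_related by blast

lemma ex_union: "\<exists>c. \<forall>x. x \<epsilon> c \<longleftrightarrow> x \<epsilon> a \<or> x \<epsilon> b"
proof -
  obtain d where d: "is_upair a b d" using ex_upair by blast
  obtain c where "\<forall>x. x \<epsilon> c \<longleftrightarrow> (\<exists>y. x \<epsilon> y \<and> y \<epsilon> d)" using union by blast
  then have "\<forall>x. x \<epsilon> c \<longleftrightarrow> x \<epsilon> a \<or> x \<epsilon> b" using d unfolding is_upair_def by auto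
  then show ?thesis ..
qed

text \<open>
  Both components \<open>{a}\<close> and \<open>{a, b}\<close> of a Kuratowski pair are subsets of \<open>A \<union> B\<close>, so the pair
  is found in the double power set of \<open>A \<union> B\<close>.
\<close>

lemma ex_prod: "\<exists>C. is_prod A B C"
proof -
  obtain D where D: "\<forall>x. x \<epsilon> D \<longleftrightarrow> x \<epsilon> A \<or> x \<epsilon> B" using ex_union by blast
  obtain P where P: "\<forall>x. x \<epsilon> P \<longleftrightarrow> (\<forall>z. z \<epsilon> x \<longrightarrow> z \<epsilon> D)" using power_set by blast
  obtain Q where Q: "\<forall>x. x \<epsilon> Q \<longleftrightarrow> (\<forall>z. z \<epsilon> x \<longrightarrow> z \<epsilon> P)" using power_set by blast
  have in_Q: "p \<epsilon> Q" if "a \<epsilon> A" "b \<epsilon> B" "is_pair a b p" for a b p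
    using that D P Q unfolding is_pair_def is_upair_def by metis
  let ?s = "undefined(3 := A, 4 := B)"
  let ?\<phi> = "FEx 1 (FEx 2 (FConj (FMem 1 3) (FConj (FMem 2 4) (FPair 1 2 0 5))))"
  have "\<exists>C. \<forall>x. x \<epsilon> C \<longleftrightarrow> x \<epsilon> Q \<and> sat E ?\<phi> (?s(0 := x))"
    using separation by blast
  then obtain C where "\<forall>x. x \<epsilon> C \<longleftrightarrow> x \<epsilon> Q \<and> (\<exists>a b. a \<epsilon> A \<and> b \<epsilon> B \<and> is_pair a b x)"
    by auto
  then have "is_prod A B C" unfolding is_prod_def using in_Q by blast
  then show ?thesis ..
qed

text \<open>
  The formula has its two arguments in the variables 1 and 2; the variable 0, which receives the
  pair in the instance of separation, must not influence it.
\<close>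

lemma ex_relation:
  assumes "\<And>p a b. sat E \<phi> (s(0 := p, 1 := a, 2 := b)) \<longleftrightarrow> Q a b"
  shows "\<exists>R. is_rel R A B \<and> (\<forall>a b. related R a b \<longleftrightarrow> a \<epsilon> A \<and> b \<epsilon> B \<and> Q a b)"
proof -
  obtain C where C: "is_prod A B C" using ex_prod by blast
  let ?\<psi> = "FEx 1 (FEx 2 (FConj (FPair 1 2 0 3) \<phi>))"
  have "\<exists>R. \<forall>x. x \<epsilon> R \<longleftrightarrow> x \<epsilon> C \<and> sat E ?\<psi> (s(0 := x))"
    using separation by blast
  then obtain R where R: "\<forall>x. x \<epsilon> R \<longleftrightarrow> x \<epsilon> C \<and> (\<exists>a b. is_pair a b x \<and> Q a b)"
    using assms by auto
  have "is_rel R A B" using R C unfolding is_rel_def is_prod_def by blast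
  moreover have "related R a b \<longleftrightarrow> a \<epsilon> A \<and> b \<epsilon> B \<and> Q a b" for a b
  proof -
    obtain p where p: "is_pair a b p" using ex_pair by blast
    then have "p \<epsilon> R \<longleftrightarrow> a \<epsilon> A \<and> b \<epsilon> B \<and> Q a b"
      using R C pair_inject unfolding is_prod_def by metis
    then show ?thesis using related_pair p by blast
  qed
  ultimately show ?thesis by blast
qed

lemma ex_const_func:
  assumes "\<And>a. a \<epsilon> A \<Longrightarrow> b \<epsilon> B"
  shows "\<exists>f. is_func f A B \<and> (\<forall>a y. related f a y \<longleftrightarrow> a \<epsilon> A \<and> y = b)"
proof -
  have "\<exists>f. is_rel f A B \<and> (\<forall>a y. related f a y \<longleftrightarrow> a \<epsilon> A \<and> y \<epsilon> B \<and> y = b)"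
    by (rule ex_relation[where s = "undefined(3 := b)" and \<phi> = "FEq 2 3"]) simp
  then obtain f where "is_rel f A B" "\<forall>a y. related f a y \<longleftrightarrow> a \<epsilon> A \<and> y \<epsilon> B \<and> y = b"
    by blast
  then show ?thesis unfolding is_func_def using assms by auto
qed

lemma ex_complement:
  "\<exists>R. \<forall>u x. related R u x \<longleftrightarrow> u \<epsilon> U \<and> x \<epsilon> X \<and> \<not> related \<alpha> u x"
proof -
  have "\<exists>R. is_rel R U X \<and> (\<forall>u x. related R u x \<longleftrightarrow> u \<epsilon> U \<and> x \<epsilon> X \<and> \<not> related \<alpha> u x)"
    by (rule ex_relation[where s = "undefined(3 := \<alpha>)" and \<phi> = "FNeg (FRelated 3 1 2 4)"]) simp
  then show ?thesis by blast
qed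

text \<open>
  Choice is applied to the set of sections \<open>{z. related R u z}\<close>. Distinct \<open>u\<close> may share a
  section and then receive the same value, which is harmless and makes this set a part of the
  power set of \<open>X\<close>.
\<close>

lemma choice_imp_uniformization:
  assumes ac: axiom_of_choice
    and total: "\<And>u. u \<epsilon> U \<Longrightarrow> \<exists>x. related R u x"
    and target: "\<And>u x. related R u x \<Longrightarrow> x \<epsilon> X"
  shows "\<exists>g. is_func g U X \<and> (\<forall>u x. related g u x \<longrightarrow> related R u x)"
proof -
  define is_section where "is_section u B \<longleftrightarrow> (\<forall>z. z \<epsilon> B \<longleftrightarrow> related R u z)" for u B
  obtain P where P: "\<forall>x. x \<epsilon> P \<longleftrightarrow> (\<forall>z. z \<epsilon> x \<longrightarrow> z \<epsilon> X)" using power_set by blast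
  let ?s = "undefined(3 := R, 4 := U)"
  let ?\<phi> = "FEx 1 (FConj (FMem 1 4) (FAll 2 (FIff (FMem 2 0) (FRelated 3 1 2 5))))"
  have "\<exists>S. \<forall>B. B \<epsilon> S \<longleftrightarrow> B \<epsilon> P \<and> sat E ?\<phi> (?s(0 := B))"
    using separation by blast
  then obtain S where S: "\<forall>B. B \<epsilon> S \<longleftrightarrow> B \<epsilon> P \<and> (\<exists>u. u \<epsilon> U \<and> is_section u B)"
    by (auto simp: is_section_def)
  have ex_section: "\<exists>B. B \<epsilon> S \<and> is_section u B" if "u \<epsilon> U" for u
  proof -
    have "\<exists>B. \<forall>z. z \<epsilon> B \<longleftrightarrow> z \<epsilon> X \<and> sat E (FRelated 3 1 0 5) ((?s(1 := u))(0 := z))"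
      using separation by blast
    then obtain B where "\<forall>z. z \<epsilon> B \<longleftrightarrow> z \<epsilon> X \<and> related R u z" by auto
    then have "is_section u B" "B \<epsilon> P" using target P unfolding is_section_def by blast+
    then show ?thesis using S that by blast
  qed
  have section_unique: "B = C" if "is_section u B" "is_section u C" for u B C
    using that extensionality unfolding is_section_def by blast
  have "\<forall>B. B \<epsilon> S \<longrightarrow> (\<exists>x. x \<epsilon> B)"
    using S total unfolding is_section_def by blast
  then obtain f W where f: "is_func f S W" and chosen: "\<forall>B x. B \<epsilon> S \<longrightarrow> related f B x \<longrightarrow> x \<epsilon> B"
    using ac unfolding axiom_of_choice_def by blast
  let ?\<psi> = "FEx 5 (FConj (FAll 6 (FIff (FMem 6 5) (FRelated 3 1 6 7))) (FRelated 4 5 2 6))"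
  have "\<exists>g. is_rel g U X \<and> (\<forall>u x. related g u x \<longleftrightarrow>
      u \<epsilon> U \<and> x \<epsilon> X \<and> (\<exists>B. is_section u B \<and> related f B x))"
    by (rule ex_relation[where s = "undefined(3 := R, 4 := f)" and \<phi> = ?\<psi>])
      (simp add: is_section_def)
  then obtain g where g: "is_rel g U X" and
    rg: "\<And>u x. related g u x \<longleftrightarrow> u \<epsilon> U \<and> x \<epsilon> X \<and> (\<exists>B. is_section u B \<and> related f B x)"
    by blast
  have sound: "related R u x" if "related g u x" for u x
    using that rg chosen func_related[OF f] unfolding is_section_def by blast
  have "\<exists>!x. related g u x" if u: "u \<epsilon> U" for u
  proof -
    obtain B where B: "B \<epsilon> S" "is_section u B" using ex_section[OF u] by blast
    then have iff: "related g u x \<longleftrightarrow> related f B x" for x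
      using rg section_unique chosen target u unfolding is_section_def by metis
    show ?thesis using f B(1) unfolding iff is_func_def by blast
  qed
  then have "is_func g U X" using g unfolding is_func_def by blast
  then show ?thesis using sound by blast
qed

section \<open>Morphisms of D(Set)\<close>

lemma hom_leE:
  assumes "hom_le DSet_hom (\<alpha>, U, X) (\<beta>, V, Y)"
  obtains f F where "\<And>u. u \<epsilon> U \<Longrightarrow> f u \<epsilon> V" "\<And>u y. u \<epsilon> U \<Longrightarrow> y \<epsilon> Y \<Longrightarrow> F u y \<epsilon> X"
    "\<And>u y. u \<epsilon> U \<Longrightarrow> y \<epsilon> Y \<Longrightarrow> related \<alpha> u (F u y) \<Longrightarrow> related \<beta> (f u) y"
proof -
  obtain f F W where f: "is_func f U V" and W: "is_prod U Y W" and F: "is_func F W X"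
    and cond: "\<And>u y p x v. u \<epsilon> U \<Longrightarrow> y \<epsilon> Y \<Longrightarrow> is_pair u y p \<Longrightarrow> related F p x \<Longrightarrow>
      related f u v \<Longrightarrow> related \<alpha> u x \<Longrightarrow> related \<beta> v y"
    using assms unfolding hom_le_def DSet_hom_def by auto
  have 1: "\<forall>u. \<exists>v. u \<epsilon> U \<longrightarrow> related f u v" using f unfolding is_func_def by blast
  have "\<exists>x p. u \<epsilon> U \<and> y \<epsilon> Y \<longrightarrow> is_pair u y p \<and> related F p x" for u y
    using ex_pair F W unfolding is_func_def is_prod_def by metis
  then have 2: "\<forall>u y. \<exists>x. u \<epsilon> U \<and> y \<epsilon> Y \<longrightarrow> (\<exists>p. is_pair u y p \<and> related F p x)" by blast
  obtain f' where f': "\<And>u. u \<epsilon> U \<Longrightarrow> related f u (f' u)" using 1 by metis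
  obtain F' where F': "\<And>u y. u \<epsilon> U \<Longrightarrow> y \<epsilon> Y \<Longrightarrow> \<exists>p. is_pair u y p \<and> related F p (F' u y)"
    using 2 by metis
  show ?thesis
  proof
    show "f' u \<epsilon> V" if "u \<epsilon> U" for u using f'[OF that] func_related[OF f] by blast
    show "F' u y \<epsilon> X" if "u \<epsilon> U" "y \<epsilon> Y" for u y
      using F'[OF that] func_related[OF F] by blast
    show "related \<beta> (f' u) y" if "u \<epsilon> U" "y \<epsilon> Y" "related \<alpha> u (F' u y)" for u y
      using F'[OF that(1,2)] f'[OF that(1)] cond that by blast
  qed
qed

text \<open>
  All morphisms built here have a constant forward component \<open>v\<close> and a backward component that
  ignores \<open>y\<close>, namely \<open>F(u, y) = g(u)\<close>. If \<open>Y\<close> is empty, \<open>F\<close> is the empty function whatever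
  \<open>g\<close> is.
\<close>

lemma hom_leI:
  assumes v: "\<And>u. u \<epsilon> U \<Longrightarrow> v \<epsilon> V"
    and g: "\<And>y. y \<epsilon> Y \<Longrightarrow> is_func g U X"
    and cond: "\<And>u y x. u \<epsilon> U \<Longrightarrow> y \<epsilon> Y \<Longrightarrow> related g u x \<Longrightarrow> related \<alpha> u x \<Longrightarrow> related \<beta> v y"
  shows "hom_le DSet_hom (\<alpha>, U, X) (\<beta>, V, Y)"
proof -
  obtain f where f: "is_func f U V" "\<And>u y. related f u y \<longleftrightarrow> u \<epsilon> U \<and> y = v"
    using ex_const_func[of U v V] v by blast
  obtain W where W: "is_prod U Y W" using ex_prod by blast
  let ?\<phi> = "FEx 4 (FEx 5 (FConj (FPair 4 5 1 6) (FRelated 3 4 2 6)))"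
  have "\<exists>F. is_rel F W X \<and> (\<forall>p x. related F p x \<longleftrightarrow>
      p \<epsilon> W \<and> x \<epsilon> X \<and> (\<exists>u y. is_pair u y p \<and> related g u x))"
    by (rule ex_relation[where s = "undefined(3 := g)" and \<phi> = ?\<phi>]) simp
  then obtain F where F: "is_rel F W X" and
    rF: "\<And>p x. related F p x \<longleftrightarrow> p \<epsilon> W \<and> x \<epsilon> X \<and> (\<exists>u y. is_pair u y p \<and> related g u x)"
    by blast
  have value_F: "related F p x \<longleftrightarrow> related g u x" if "u \<epsilon> U" "y \<epsilon> Y" "is_pair u y p" for u y p x
  proof -
    have "p \<epsilon> W" using W that unfolding is_prod_def by blast
    then show ?thesis
      using rF pair_inject that func_related[OF g] by metis
  qed
  have "\<exists>!x. related F p x" if "p \<epsilon> W" for p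
  proof -
    obtain u y where uy: "u \<epsilon> U" "y \<epsilon> Y" "is_pair u y p"
      using W \<open>p \<epsilon> W\<close> unfolding is_prod_def by blast
    show ?thesis using g[OF uy(2)] uy(1) unfolding value_F[OF uy] is_func_def by blast
  qed
  then have "is_func F W X" using F unfolding is_func_def by blast
  then have "(f, F) \<in> DSet_hom (\<alpha>, U, X) (\<beta>, V, Y)"
    using f W value_F cond unfolding DSet_hom_def by auto
  then show ?thesis unfolding hom_le_def by blast
qed

lemma hom_le_const:
  assumes v: "\<And>u. u \<epsilon> U \<Longrightarrow> v \<epsilon> V"
    and x: "\<And>u y. u \<epsilon> U \<Longrightarrow> y \<epsilon> Y \<Longrightarrow> x \<epsilon> X"
    and cond: "\<And>u y. u \<epsilon> U \<Longrightarrow> y \<epsilon> Y \<Longrightarrow> related \<alpha> u x \<Longrightarrow> related \<beta> v y"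
  shows "hom_le DSet_hom (\<alpha>, U, X) (\<beta>, V, Y)"
proof (cases "\<exists>y. y \<epsilon> Y")
  case True
  then obtain g where "is_func g U X" "\<forall>u z. related g u z \<longleftrightarrow> u \<epsilon> U \<and> z = x"
    using ex_const_func[of U x X] x by blast
  then show ?thesis using v cond by (intro hom_leI) auto
next
  case False
  then show ?thesis using v by (intro hom_leI) auto
qed

text \<open>
  When \<open>\<beta>\<close> is empty, the condition on a morphism forbids \<open>F(u, y)\<close> to be \<open>\<alpha>\<close>-related to \<open>u\<close>; at
  a fixed \<open>y\<close> this is a function selecting a refutation of each \<open>u\<close>.
\<close>

lemma refutation_of_hom_le_empty:
  assumes le: "hom_le DSet_hom (\<alpha>, U, X) (\<beta>, V, Y)"
    and y: "y \<epsilon> Y" and empty: "\<And>v z. \<not> related \<beta> v z"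
  shows "\<exists>g. is_func g U X \<and> (\<forall>u x. related g u x \<longrightarrow> \<not> related \<alpha> u x)"
proof -
  obtain f F W where f: "is_func f U V" and W: "is_prod U Y W" and F: "is_func F W X"
    and cond: "\<And>u y p x v. u \<epsilon> U \<Longrightarrow> y \<epsilon> Y \<Longrightarrow> is_pair u y p \<Longrightarrow> related F p x \<Longrightarrow>
      related f u v \<Longrightarrow> related \<alpha> u x \<Longrightarrow> related \<beta> v y"
    using le unfolding hom_le_def DSet_hom_def by auto
  let ?\<phi> = "FEx 5 (FConj (FPair 1 4 5 6) (FRelated 3 5 2 6))"
  have "\<exists>g. is_rel g U X \<and> (\<forall>u x. related g u x \<longleftrightarrow>
      u \<epsilon> U \<and> x \<epsilon> X \<and> (\<exists>p. is_pair u y p \<and> related F p x))"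
    by (rule ex_relation[where s = "undefined(3 := F, 4 := y)" and \<phi> = ?\<phi>]) simp
  then obtain g where g: "is_rel g U X" and
    rg: "\<And>u x. related g u x \<longleftrightarrow> u \<epsilon> U \<and> x \<epsilon> X \<and> (\<exists>p. is_pair u y p \<and> related F p x)"
    by blast
  have "\<exists>!x. related g u x" if u: "u \<epsilon> U" for u
  proof -
    obtain p where p: "is_pair u y p" using ex_pair by blast
    then have "p \<epsilon> W" using W u y unfolding is_prod_def by blast
    have iff: "related g u x \<longleftrightarrow> related F p x" for x
      using rg u p pair_unique func_related[OF F] by metis
    show ?thesis using F \<open>p \<epsilon> W\<close> unfolding iff is_func_def by blast
  qed
  then have "is_func g U X" using g unfolding is_func_def by blast
  moreover have "\<not> related \<alpha> u x" if "related g u x" for u x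
    using that rg cond y empty f unfolding is_func_def by metis
  ultimately show ?thesis by blast
qed

section \<open>The shadow of an object\<close>

definition shadow :: "'v \<times> 'v \<times> 'v \<Rightarrow> bool \<times> bool \<times> bool" where
  "shadow = (\<lambda>(\<alpha>, U, X).
     ((\<exists>x. x \<epsilon> X) \<and> (\<exists>u. u \<epsilon> U \<and> (\<forall>x. x \<epsilon> X \<longrightarrow> related \<alpha> u x)),
      \<exists>u. u \<epsilon> U,
      (\<exists>u. u \<epsilon> U) \<and> (\<exists>x. x \<epsilon> X)))"

lemma shadow_in_dprime: "shadow A \<in> dprime"
  by (cases A) (auto simp: shadow_def dprime_def)

lemma shadow_mono:
  assumes "hom_le DSet_hom A B"
  shows "dprime_le (shadow A) (shadow B)"
proof -
  obtain \<alpha> U X \<beta> V Y where AB: "A = (\<alpha>, U, X)" "B = (\<beta>, V, Y)" by (metis prod_cases3)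
  obtain f F where f: "\<And>u. u \<epsilon> U \<Longrightarrow> f u \<epsilon> V"
    and F: "\<And>u y. u \<epsilon> U \<Longrightarrow> y \<epsilon> Y \<Longrightarrow> F u y \<epsilon> X"
    and cond: "\<And>u y. u \<epsilon> U \<Longrightarrow> y \<epsilon> Y \<Longrightarrow> related \<alpha> u (F u y) \<Longrightarrow> related \<beta> (f u) y"
    using assms hom_leE unfolding AB by blast
  have "\<exists>v. v \<epsilon> V \<and> (\<forall>y. y \<epsilon> Y \<longrightarrow> related \<beta> v y)"
    if "u \<epsilon> U" "\<forall>x. x \<epsilon> X \<longrightarrow> related \<alpha> u x" for u
    using that f F cond by blast
  then show ?thesis
    using f F unfolding AB shadow_def dprime_le_def
    by (simp only: prod.case le_bool_def inf_bool_def) blast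
qed

text \<open>
  For each inequality of shadows a constant morphism is at hand, except possibly when the shadow
  of the source is \<open>(False, True, True)\<close>; a function selecting refutations replaces the constant
  there.
\<close>

lemma hom_le_if_shadow_le:
  assumes le: "dprime_le (shadow (\<alpha>, U, X)) (shadow (\<beta>, V, Y))"
    and refutation: "shadow (\<alpha>, U, X) = (False, True, True) \<Longrightarrow>
      \<exists>g. is_func g U X \<and> (\<forall>u x. related g u x \<longrightarrow> \<not> related \<alpha> u x)"
  shows "hom_le DSet_hom (\<alpha>, U, X) (\<beta>, V, Y)"
proof -
  consider (empty) "\<not> (\<exists>u. u \<epsilon> U)"
    | (no_test) v where "v \<epsilon> V" "\<not> (\<exists>y. y \<epsilon> Y)"
    | (winning) v x where "v \<epsilon> V" "\<forall>y. y \<epsilon> Y \<longrightarrow> related \<beta> v y" "x \<epsilon> X"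
    | (refuted) v where "v \<epsilon> V" "shadow (\<alpha>, U, X) = (False, True, True)"
    using le unfolding shadow_def dprime_le_def
    by (simp only: prod.case le_bool_def inf_bool_def prod.inject) blast
  then show ?thesis
  proof cases
    case empty
    then show ?thesis by (intro hom_le_const) auto
  next
    case no_test
    then show ?thesis by (intro hom_le_const) auto
  next
    case winning
    then show ?thesis by (intro hom_le_const) auto
  next
    case refuted
    then show ?thesis using refutation by (blast intro: hom_leI)
  qed
qed

lemma choice_imp_refutation:
  assumes axiom_of_choice "shadow (\<alpha>, U, X) = (False, True, True)"
  shows "\<exists>g. is_func g U X \<and> (\<forall>u x. related g u x \<longrightarrow> \<not> related \<alpha> u x)"
proof -
  obtain R where R: "\<And>u x. related R u x \<longleftrightarrow> u \<epsilon> U \<and> x \<epsilon> X \<and> \<not> related \<alpha> u x"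
    using ex_complement by blast
  have "\<exists>x. related R u x" if "u \<epsilon> U" for u
    using assms(2) that R unfolding shadow_def by auto
  then show ?thesis using choice_imp_uniformization[of U R X] assms(1) R by blast
qed

text \<open>
  The four witnesses are built from an empty set and a singleton. The one of shadow
  \<open>(False, True, True)\<close> is an empty relation between inhabited sets, and this will force
  the backward component of a morphism into it to select refutations.
\<close>

lemma shadow_witness:
  assumes "d \<in> dprime"
  shows "\<exists>\<alpha> U X. (\<alpha>, U, X) \<in> DSet_obj \<and> shadow (\<alpha>, U, X) = d \<and>
    hom_le DSet_hom (\<alpha>, U, X) (\<alpha>, U, X) \<and>
    (d = (False, True, True) \<longrightarrow> (\<exists>x. x \<epsilon> X) \<and> (\<forall>u x. \<not> related \<alpha> u x))"
proof -
  obtain e where e: "\<And>z. \<not> z \<epsilon> e" using ex_empty by blast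
  obtain i where "is_upair e e i" using ex_upair by blast
  then have i: "z \<epsilon> i \<longleftrightarrow> z = e" for z unfolding is_upair_def by simp
  obtain t where t: "is_prod i i t" using ex_prod by blast
  have no: "\<not> related e u x" for u x using e unfolding related_def by blast
  have yes: "related t e e" using t i ex_pair unfolding is_prod_def related_def by metis
  have obj: "(e, U, X) \<in> DSet_obj" for U X using e by (simp add: DSet_obj_def is_rel_def)
  have "(t, i, i) \<in> DSet_obj" using t by (auto simp: DSet_obj_def is_rel_def is_prod_def)
  have refl: "hom_le DSet_hom (e, U, X) (e, U, X)" if "U = e \<or> U = i" "X = e \<or> X = i" for U X
    using that e i no by (intro hom_le_const[where v = e and x = e]) auto
  consider "d = (False, False, False)" | "d = (False, True, False)"
    | "d = (False, True, True)" | "d = (True, True, True)"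
    using assms by (cases d) (auto simp: dprime_def)
  then show ?thesis
  proof cases
    case 1
    then show ?thesis using obj[of e e] refl[of e e] e
      by (intro exI[of _ e]) (simp add: shadow_def)
  next
    case 2
    then show ?thesis using obj[of i e] refl[of i e] e i
      by (intro exI[of _ e] exI[of _ i]) (simp add: shadow_def)
  next
    case 3
    then show ?thesis using obj[of i i] refl[of i i] i no
      by (intro exI[of _ e] exI[of _ i]) (simp add: shadow_def)
  next
    case 4
    have "hom_le DSet_hom (t, i, i) (t, i, i)"
      using i yes by (intro hom_le_const[where v = e and x = e]) auto
    then show ?thesis using 4 \<open>(t, i, i) \<in> DSet_obj\<close> i yes
      by (intro exI[of _ t] exI[of _ i]) (simp add: shadow_def)
  qed
qed

lemma dprime_le_refl: "dprime_le (d :: bool \<times> bool \<times> bool) d"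
  by (cases d) (simp add: dprime_le_def)

lemma dprime_le_antisym:
  "d \<in> dprime \<Longrightarrow> e \<in> dprime \<Longrightarrow> dprime_le d e \<Longrightarrow> dprime_le e d \<Longrightarrow> d = e"
  for d e :: "bool \<times> bool \<times> bool"
  unfolding dprime_le_def dprime_def le_bool_def inf_bool_def
  by (cases d; cases e) fastforce

section \<open>The poset reflection of D(Set) and choice\<close>

lemma choice_imp_order_isomorphic:
  assumes axiom_of_choice
  shows "order_isomorphic (dprime :: (bool \<times> bool \<times> bool) set) dprime_le PDSet PDSet_le"
  unfolding PDSet_def PDSet_le_def
proof (rule order_isomorphic_reflection_of_invariant[where g = shadow])
  show "shadow ` DSet_obj = dprime"
    using shadow_in_dprime shadow_witness by (auto simp: image_iff) metis
  show "hom_le DSet_hom A B \<longleftrightarrow> dprime_le (shadow A) (shadow B)" for A B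
    using shadow_mono hom_le_if_shadow_le choice_imp_refutation[OF assms]
    by (metis prod_cases3)
qed (simp_all add: dprime_le_refl dprime_le_antisym)

lemma order_isomorphic_imp_refutation:
  assumes iso: "order_isomorphic (dprime :: (bool \<times> bool \<times> bool) set) dprime_le PDSet PDSet_le"
    and obj: "(\<alpha>, U, X) \<in> DSet_obj" and sh: "shadow (\<alpha>, U, X) = (False, True, True)"
  shows "\<exists>g. is_func g U X \<and> (\<forall>u x. related g u x \<longrightarrow> \<not> related \<alpha> u x)"
proof -
  have "\<forall>d. \<exists>C. d \<in> dprime \<longrightarrow> C \<in> DSet_obj \<and> shadow C = d \<and> hom_le DSet_hom C C \<and>
    (d = (False, True, True) \<longrightarrow>
      (\<exists>\<beta> V Y. C = (\<beta>, V, Y) \<and> (\<exists>y. y \<epsilon> Y) \<and> (\<forall>v y. \<not> related \<beta> v y)))"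
    using shadow_witness by metis
  then obtain c where c: "\<And>d. d \<in> dprime \<Longrightarrow> c d \<in> DSet_obj \<and> shadow (c d) = d"
    "\<And>d. d \<in> dprime \<Longrightarrow> hom_le DSet_hom (c d) (c d)"
    and c0: "\<exists>\<beta> V Y. c (False, True, True) = (\<beta>, V, Y) \<and> (\<exists>y. y \<epsilon> Y) \<and>
      (\<forall>v y. \<not> related \<beta> v y)"
    using shadow_in_dprime sh by metis
  have "((\<alpha>, U, X), c (shadow (\<alpha>, U, X))) \<in> hom_equiv DSet_obj DSet_hom"
    by (rule equivalent_to_section_of_invariant[OF _ c, where le = dprime_le and le' = PDSet_le])
      (use iso obj in \<open>simp_all add: PDSet_def shadow_in_dprime shadow_mono dprime_le_antisym\<close>)
  then have "hom_le DSet_hom (\<alpha>, U, X) (c (False, True, True))"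
    unfolding sh hom_equiv_def by simp
  then show ?thesis using c0 refutation_of_hom_le_empty by metis
qed

lemma order_isomorphic_imp_choice:
  assumes iso: "order_isomorphic (dprime :: (bool \<times> bool \<times> bool) set) dprime_le PDSet PDSet_le"
  shows axiom_of_choice
  unfolding axiom_of_choice_def
proof (intro allI impI)
  fix S assume inhabited: "\<forall>s. s \<epsilon> S \<longrightarrow> (\<exists>x. x \<epsilon> s)"
  obtain X where X: "\<forall>x. x \<epsilon> X \<longleftrightarrow> (\<exists>s. x \<epsilon> s \<and> s \<epsilon> S)" using union by blast
  have "\<exists>\<alpha>. is_rel \<alpha> S X \<and> (\<forall>s x. related \<alpha> s x \<longleftrightarrow> s \<epsilon> S \<and> x \<epsilon> X \<and> \<not> x \<epsilon> s)"
    by (rule ex_relation[where \<phi> = "FNeg (FMem 2 1)"]) simp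
  then obtain \<alpha> where \<alpha>: "is_rel \<alpha> S X"
    and r\<alpha>: "\<And>s x. related \<alpha> s x \<longleftrightarrow> s \<epsilon> S \<and> x \<epsilon> X \<and> \<not> x \<epsilon> s"
    by blast
  show "\<exists>f W. is_func f S W \<and> (\<forall>s x. s \<epsilon> S \<longrightarrow> related f s x \<longrightarrow> x \<epsilon> s)"
  proof (cases "\<exists>s. s \<epsilon> S")
    case True
    then have "shadow (\<alpha>, S, X) = (False, True, True)"
      using inhabited X r\<alpha> unfolding shadow_def by simp blast
    then obtain g where "is_func g S X" "\<forall>s x. related g s x \<longrightarrow> \<not> related \<alpha> s x"
      using order_isomorphic_imp_refutation[OF iso, of \<alpha> S X] \<alpha>
      by (auto simp: DSet_obj_def)
    then show ?thesis using r\<alpha> func_related by blast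
  next
    case False
    then show ?thesis using ex_const_func[of S] by blast
  qed
qed

end

theorem theorem4:
  fixes E :: "'v \<Rightarrow> 'v \<Rightarrow> bool"
  assumes "ZF_model E"
  shows "order_isomorphic (dprime :: (bool \<times> bool \<times> bool) set) dprime_le
           (set_structure.PDSet E) (set_structure.PDSet_le E)
         \<longleftrightarrow> set_structure.axiom_of_choice E"
proof -
  interpret ZF_model E by (rule assms)
  show ?thesis
    using choice_imp_order_isomorphic order_isomorphic_imp_choice by blast
qed

end
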